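(* Let $V=\{1, 3, 8, 120, 2, 4, 12, 20, 24, 6, 22, 92, 204, 420, 36, 78, 84, 140, 210, 360, 364, 560, 60, 14, 40, 136, 220, 312, 33, 9, 10, 52, 56, 728, 11, 48, 90, 168, 408, 840, 5, 7, 28, 30, 34, 35, 46, 70, 88, 132, 180, 240, 2184, 280, 16, 21, 32, 44, 156, 816, 380, 13, 39, 72, 80, 96, 462, 528, 1140, 2380, 23, 102, 105, 110, 152, 264, 456, 858, 2520, 1365\}$. Then the graph $D(V)$ has chromatic number five.
   Context: For a finite set $V$ of positive integers, the Diophantine graph $D(V)$ has vertex set $V$, and two distinct elements $a,b\in V$ are linked by an edge if and only if $ab+1$ is a perfect square. *)

theory Defs
  imports "Graph_Theory.Pair_Digraph" "HOL-Computational_Algebra.Nth_Powers"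
begin

text \<open>A simple graph is a symmetric loop-free \<open>pair_pre_digraph\<close> (locale \<open>pair_graph\<close>);
  an undirected edge is the pair of its two arcs.\<close>

definition diophantine_graph :: "nat set \<Rightarrow> nat pair_pre_digraph" where
  "diophantine_graph V =
    \<lparr> pverts = V,
      parcs = {(a, b). a \<in> V \<and> b \<in> V \<and> a \<noteq> b \<and> is_nth_power 2 (a * b + 1)} \<rparr>"

definition proper_coloring :: "'a pair_pre_digraph \<Rightarrow> nat \<Rightarrow> ('a \<Rightarrow> nat) \<Rightarrow> bool" where
  "proper_coloring G k c \<longleftrightarrow>
    c ` pverts G \<subseteq> {..<k} \<and> (\<forall>(u, v) \<in> parcs G. c u \<noteq> c v)"

text \<open>Meaningful only if some finite number of colors suffices, as it does for every
  finite graph (lemma \<open>ex_chromatic_number_coloring\<close>).\<close>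

definition chromatic_number :: "'a pair_pre_digraph \<Rightarrow> nat" where
  "chromatic_number G = (LEAST k. \<exists>c. proper_coloring G k c)"

lemma pair_graph_diophantine_graph:
  assumes "finite V"
  shows "pair_graph (diophantine_graph V)"
proof
  show "finite (parcs (diophantine_graph V))"
    by (rule finite_subset[of _ "V \<times> V"]) (auto simp: diophantine_graph_def assms)
  show "symmetric (diophantine_graph V)"
    unfolding symmetric_def by (auto simp: diophantine_graph_def mult.commute intro!: symI)
qed (auto simp: diophantine_graph_def assms)

lemma (in pair_graph) ex_chromatic_number_coloring:
  "\<exists>c. proper_coloring G (chromatic_number G) c"
proof -
  obtain c where c: "bij_betw c (pverts G) {0..<card (pverts G)}"
    using ex_bij_betw_finite_nat pair_finite_verts by blast
  have "c u \<noteq> c v" if "(u, v) \<in> parcs G" for u v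
    using that c pair_no_loops in_arcsD1 in_arcsD2
    by (metis bij_betw_imp_inj_on fst_conv inj_onD snd_conv)
  then have "proper_coloring G (card (pverts G)) c"
    using c by (auto simp: proper_coloring_def bij_betw_def)
  then show ?thesis
    unfolding chromatic_number_def by (rule LeastI[of "\<lambda>k. \<exists>c. proper_coloring G k c", OF exI])
qed

end

theory Submission
  imports Defs "HOL-Library.Discrete_Functions"
begin

text \<open>Five independent sets covering the vertices are listed explicitly. Conversely, \<open>{1, 3, 8, 120}\<close>
  is a clique, so in a colouring with at most four colours these vertices receive distinct colours
  and every vertex shares the colour of one of them. The resulting finite propositional
  problem is refuted by SAT solving.\<close>

text \<open>If s is the root of \<open>n div 4\<close>, then 4 s^2 \<le> n < 4 (s + 1)^2, so the
  root of n is 2 s or 2 s + 1, and one comparison decides. On numerals this computes roots in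
  logarithmically many steps.\<close>

lemma floor_sqrt_rec:
  "floor_sqrt n = (let r = 2 * floor_sqrt (n div 4) in if (Suc r)\<^sup>2 \<le> n then Suc r else r)"
proof -
  define s where "s = floor_sqrt (n div 4)"
  have "s\<^sup>2 \<le> n div 4" "n div 4 < (Suc s)\<^sup>2"
    unfolding s_def by (rule floor_sqrt_power2_le, rule Suc_floor_sqrt_power2_gt)
  then have "4 * s\<^sup>2 \<le> n" "n < 4 * (Suc s)\<^sup>2"
    by linarith+
  then have "(2 * s)\<^sup>2 \<le> n" "n < (Suc (Suc (2 * s)))\<^sup>2"
    by (simp_all add: power2_eq_square)
  then show ?thesis
    unfolding s_def[symmetric] Let_def by (auto intro!: floor_sqrt_unique)
qed

text \<open>Restricted to numerals so that it can be used as a terminating rewrite rule.\<close>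

lemmas floor_sqrt_numeral = floor_sqrt_rec[of "numeral k" for k]

lemma is_nth_power_2_iff_floor_sqrt: "is_nth_power 2 n \<longleftrightarrow> (floor_sqrt n)\<^sup>2 = n"
  by (metis floor_sqrt_inverse_power2 is_nth_power_def)

definition dioph_vertices :: "nat set" where
  "dioph_vertices = {1, 3, 8, 120, 2, 4, 12, 20, 24, 6, 22, 92, 204, 420, 36, 78, 84, 140, 210, 360,
    364, 560, 60, 14, 40, 136, 220, 312, 33, 9, 10, 52, 56, 728, 11, 48, 90, 168, 408, 840, 5, 7,
    28, 30, 34, 35, 46, 70, 88, 132, 180, 240, 2184, 280, 16, 21, 32, 44, 156, 816, 380, 13, 39,
    72, 80, 96, 462, 528, 1140, 2380, 23, 102, 105, 110, 152, 264, 456, 858, 2520, 1365}"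

text \<open>Each listed edge is stored once, at its smaller endpoint. The list serves the lower
  bound; the upper bound tests pairs inside the colour classes directly.\<close>

definition dioph_adjacency :: "(nat \<times> nat list) list" where
  "dioph_adjacency =
    [(1, [3, 8, 24, 35, 48, 80, 120, 168, 360, 528, 728, 840]), (2, [4, 12, 24, 40, 60, 84, 180,
    220, 264, 312, 364, 420, 840, 2380, 2520]), (3, [5, 8, 16, 21, 33, 40, 56, 96, 120, 280,
    408, 456, 560, 1365]), (4, [6, 12, 20, 30, 56, 72, 90, 110, 132, 156, 210, 240, 380, 420,
    462]), (5, [7, 16, 24, 39, 72, 88, 168]), (6, [8, 20, 28, 48, 60, 88, 140, 204, 280, 840]),
    (7, [9, 24, 32, 120, 240, 264]), (8, [10, 21, 28, 36, 78, 105, 120, 136, 210, 528]), (9,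
    [11, 32, 40, 136, 152, 312, 560]), (10, [12, 36, 44, 84, 96, 152, 168, 240]), (11, [13, 40,
    48, 105, 168, 408, 2184]), (12, [14, 24, 30, 44, 52, 70, 80, 102, 140, 420, 2380]), (13,
    [48, 56, 456, 816, 2520]), (14, [16, 52, 60, 120, 132, 360]), (16, [33, 39, 60, 105, 264]),
    (20, [22, 48, 84, 120, 312, 858, 1140, 2184]), (21, [23, 40, 80, 88, 240]), (22, [24, 84,
    92, 204, 360, 560]), (23, [88, 96, 360, 816, 840]), (24, [35, 40, 70, 92, 210, 1365, 2380]),
    (28, [30, 60, 180, 456, 858]), (30, [32, 56, 80, 168, 264]), (32, [34, 132, 1140, 1365]),
    (33, [35, 56, 136, 240, 360, 728]), (34, [36, 132, 140, 312, 840]), (35, [48, 136, 280,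
    816]), (36, [78, 84, 140, 220]), (39, [72, 105, 152, 840]), (40, [60, 156]), (44, [46, 96,
    102, 180, 280]), (46, [48, 180, 408, 420, 728, 1140]), (48, [88, 105]), (52, [120, 204, 462,
    840, 2184]), (56, [90, 168, 220]), (60, [84, 132, 380, 728]), (70, [72, 140, 408, 816,
    2184]), (72, [110, 360]), (78, [80, 136, 220, 420, 560]), (80, [456, 2520]), (84, [152,
    462]), (88, [90, 140]), (90, [92, 132, 364, 816]), (92, [204, 210, 364]), (96, [168, 380,
    858]), (102, [280, 560, 1140]), (105, [312]), (110, [156, 360, 528]), (120, [364]), (136,
    [210, 420, 2184]), (140, [204, 312, 408]), (152, [240, 462]), (156, [210, 280, 528, 728]),
    (180, [220, 408]), (204, [280, 360, 456, 462]), (210, [728]), (220, [264, 560]), (240,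
    [840]), (264, [312]), (312, [364]), (360, [560, 1365]), (364, [420, 816]), (380, [462, 858,
    2184, 2380]), (408, [728, 816]), (456, [1140]), (462, [2520]), (528, [2380]), (560, [1140]),
    (728, [1140]), (858, [1140, 2380]), (2380, [2520])]"

text \<open>An explicit witness for the upper bound; the position of a class in the list is its
  colour.\<close>

definition color_classes :: "nat set list" where
  "color_classes =
    [
     {1, 2, 6, 7, 10, 11, 14, 21, 34, 39, 46, 56, 70, 92, 136, 156, 380, 456, 560, 1365},
     {3, 4, 9, 24, 28, 44, 52, 80, 84, 105, 140, 168, 264, 360, 528, 816, 1140},
     {8, 12, 13, 16, 20, 35, 40, 72, 88, 96, 132, 204, 220, 240, 364, 728},
     {5, 22, 23, 32, 33, 36, 48, 60, 90, 110, 120, 210, 280, 312, 408, 420, 462, 2184, 2380},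
     {30, 78, 102, 152, 180, 840, 858, 2520}]"

lemma dioph_adjacency_square:
  "\<forall>(a, bs) \<in> set dioph_adjacency. \<forall>b \<in> set bs. is_nth_power 2 (a * b + 1)"
  unfolding dioph_adjacency_def
  \<comment> \<open>\<open>let_weak_cong\<close> makes the simplifier evaluate the recursive root
    bound by \<open>let\<close> without entering the body.\<close>
  by (simp add: is_nth_power_2_iff_floor_sqrt floor_sqrt_numeral cong: let_weak_cong)

lemma dioph_adjacency_vertices:
  "\<forall>(a, bs) \<in> set dioph_adjacency. a \<in> dioph_vertices \<and> (\<forall>b \<in> set bs. b \<in> dioph_vertices \<and> a < b)"
  unfolding dioph_adjacency_def dioph_vertices_def by simp

lemma Union_color_classes: "dioph_vertices \<subseteq> \<Union>(set color_classes)"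
  unfolding dioph_vertices_def color_classes_def by simp

lemma color_classes_independent:
  "\<forall>C \<in> set color_classes. \<forall>a \<in> C. \<forall>b \<in> C. a < b \<longrightarrow> \<not> is_nth_power 2 (a * b + 1)"
  unfolding color_classes_def
  by (simp add: is_nth_power_2_iff_floor_sqrt floor_sqrt_numeral cong: let_weak_cong)

text \<open>The four classes are predicates, so that instances such as \<open>P 24\<close> act as
  propositional variables once the lists are unfolded. Fixing the classes of the clique removes the
  symmetry between the colours.\<close>

lemma no_four_independent_classes:
  fixes P Q R S :: "nat \<Rightarrow> bool"
  assumes cover: "\<forall>a\<in>dioph_vertices. P a \<or> Q a \<or> R a \<or> S a"
    and indep: "\<forall>(a, bs) \<in> set dioph_adjacency. \<forall>b \<in> set bs.
      \<not> (P a \<and> P b) \<and> \<not> (Q a \<and> Q b) \<and> \<not> (R a \<and> R b) \<and> \<not> (S a \<and> S b)"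
    and clique: "P 1" "Q 3" "R 8" "S 120"
  shows False
proof -
  \<comment> \<open>Otherwise \<open>P 1\<close> would become \<open>P (Suc 0)\<close> in the
    simplified facts and no longer be the same atom as in \<open>clique\<close>.\<close>
  note [simp del] = One_nat_def
  note c = cover[unfolded dioph_vertices_def, simplified]
  note i = indep[unfolded dioph_adjacency_def, simplified]
  show False using c i clique by sat
qed

lemma proper_coloring_dioph_adjacency:
  assumes "proper_coloring (diophantine_graph dioph_vertices) k c"
  shows "\<forall>(a, bs) \<in> set dioph_adjacency. \<forall>b \<in> set bs. c a \<noteq> c b"
proof (clarify)
  fix a bs b
  assume "(a, bs) \<in> set dioph_adjacency" "b \<in> set bs" "c a = c b"
  moreover from this have "(a, b) \<in> parcs (diophantine_graph dioph_vertices)"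
    using dioph_adjacency_square dioph_adjacency_vertices
    by (fastforce simp: diophantine_graph_def)
  ultimately show False
    using assms by (auto simp: proper_coloring_def)
qed

lemma proper_coloring_ge_5:
  assumes col: "proper_coloring (diophantine_graph dioph_vertices) k c"
  shows "5 \<le> k"
proof (rule ccontr)
  assume "\<not> 5 \<le> k"
  then have less: "c a < 4" if "a \<in> dioph_vertices" for a
    using col that by (fastforce simp: proper_coloring_def diophantine_graph_def)
  note adj = proper_coloring_dioph_adjacency[OF col]
  have "distinct [c 1, c 3, c 8, c 120]"
    using adj by (simp add: dioph_adjacency_def)
  moreover have "c 1 < 4" "c 3 < 4" "c 8 < 4" "c 120 < 4"
    by (simp_all add: less dioph_vertices_def)
  ultimately have "{c 1, c 3, c 8, c 120} = {..<4}"
    by (intro card_subset_eq) auto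
  then have cover:
    "\<forall>a\<in>dioph_vertices. c a = c 1 \<or> c a = c 3 \<or> c a = c 8 \<or> c a = c 120"
    using less by blast
  \<comment> \<open>Unification with \<open>cover\<close> makes \<open>P\<close>, \<open>Q\<close>,
    \<open>R\<close>, \<open>S\<close> say that a vertex has the colour of 1, 3, 8, 120
    respectively. Two adjacent vertices in one class would then have equal colours, against
    \<open>adj\<close>.\<close>
  show False
    using adj by (intro no_four_independent_classes[OF cover]) fastforce+
qed

lemma ex_proper_coloring_5: "\<exists>c. proper_coloring (diophantine_graph dioph_vertices) 5 c"
proof -
  have "\<exists>i<5. a \<in> color_classes ! i" if "a \<in> dioph_vertices" for a
  proof -
    have "length color_classes = 5"
      by (simp add: color_classes_def)
    then show ?thesis
      using Union_color_classes that by (force simp: in_set_conv_nth)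
  qed
  \<comment> \<open>Choosing one class index for each vertex gives a function even without
    disjointness of the classes.\<close>
  then obtain c where c: "c a < 5" "a \<in> color_classes ! c a" if "a \<in> dioph_vertices" for a
    by metis
  have ne: "c a \<noteq> c b"
    if "a \<in> dioph_vertices" "b \<in> dioph_vertices" "a < b" "is_nth_power 2 (a * b + 1)" for a b
  proof
    assume "c a = c b"
    moreover have "color_classes ! c a \<in> set color_classes"
      using c(1)[OF that(1)] by (intro nth_mem) (simp add: color_classes_def)
    ultimately show False
      using color_classes_independent c(2) that by metis
  qed
  \<comment> \<open>Arcs run in both directions, while \<open>ne\<close> covers only a < b;
    commutativity of the product gives the other order.\<close>
  have "c a \<noteq> c b" if "(a, b) \<in> parcs (diophantine_graph dioph_vertices)" for a b
    using that ne[of a b] ne[of b a]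
    by (cases a b rule: linorder_cases) (auto simp: diophantine_graph_def mult.commute)
  then have "proper_coloring (diophantine_graph dioph_vertices) 5 c"
    using c(1) by (auto simp: proper_coloring_def diophantine_graph_def)
  then show ?thesis
    by blast
qed

theorem theorem5:
  fixes V :: "nat set"
  assumes "V = {1, 3, 8, 120, 2, 4, 12, 20, 24, 6, 22, 92, 204, 420, 36, 78, 84, 140, 210, 360,
    364, 560, 60, 14, 40, 136, 220, 312, 33, 9, 10, 52, 56, 728, 11, 48, 90, 168, 408, 840, 5, 7,
    28, 30, 34, 35, 46, 70, 88, 132, 180, 240, 2184, 280, 16, 21, 32, 44, 156, 816, 380, 13, 39,
    72, 80, 96, 462, 528, 1140, 2380, 23, 102, 105, 110, 152, 264, 456, 858, 2520, 1365}"
  shows "chromatic_number (diophantine_graph V) = 5"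
proof -
  have "V = dioph_vertices"
    unfolding dioph_vertices_def by (fact assms)
  then show ?thesis
    unfolding chromatic_number_def
    using ex_proper_coloring_5 proper_coloring_ge_5 by (auto intro!: Least_equality)
qed

end
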